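(* Let $\hbar\in\mathbb{R}$, $\hbar\neq 0$, let $S^2_\hbar$ be the fuzzy sphere with hermitian generators $X^1,X^2,X^3$, let $\Pi^{ij}=X^iX^j$, $\mathcal{D}^{ij}=\delta^{ij}\mathbb{1}-X^iX^j$, and let $\tilde{R}^{ijkl}$ and $S$ be the associated curvature components and scalar curvature (as defined in the context). Then for all $i,j,k,l\in\{1,2,3\}$ (summing over the repeated indices $p,q\in\{1,2,3\}$) $$\begin{aligned}\tilde{R}^{ijkl} &= \big(\varepsilon^{ikp}\varepsilon^{jlq}-\varepsilon^{jkp}\varepsilon^{ilq}\big)X^pX^q - i\hbar\,\varepsilon^{jlq}X^kX^iX^q - i\hbar\,\varepsilon^{jkp}X^pX^iX^l\\ &\quad + i\hbar\,\varepsilon^{ikp}X^pX^jX^l + i\hbar\,\varepsilon^{ilq}X^kX^jX^q + i\hbar\,\varepsilon^{ijp}X^kX^pX^l,\end{aligned}$$ and $$S=\big(2-3\hbar^2+\hbar^4\big)\mathbb{1}.$$ (In the coefficients, as opposed to superscripts, $i$ denotes the imaginary unit.)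
   Context: Repeated indices are summed over $\{1,2,3\}$; there is no difference between upper and lower indices. $\varepsilon^{ijk}$ is totally antisymmetric with $\varepsilon^{123}=1$. The fuzzy sphere $S^2_\hbar$ is the unital associative $*$-algebra over $\mathbb{C}$ on three hermitian generators $X^1,X^2,X^3$ with relations $[X^i,X^j]=i\hbar\,\varepsilon^{ijk}X^k$ and $(X^1)^2+(X^2)^2+(X^3)^2=\mathbb{1}$. $\Pi=(\Pi^{ij})$ with $\Pi^{ij}=X^iX^j$ is a projection acting on the free right module $(S^2_\hbar)^3$, and $\mathcal{D}=\mathbb{1}-\Pi$ is the complementary projection. The inner derivations are $\partial^i(a)=\frac{1}{i\hbar}[X^i,a]$ for $a\in S^2_\hbar$. On the projective module $TS^2_\hbar=\mathcal{D}((S^2_\hbar)^3)$ one has the connection $\nabla^iU=\nabla_{\partial^i}U=e_k\mathcal{D}^{kl}\partial^i(U^l)$ for $U=e_kU^k$, where $\{e_k\}$ is the canonical basis of $(S^2_\hbar)^3$. Its curvature $\nabla^i\nabla^jU-\nabla^j\nabla^iU-\nabla_{[\partial^i,\partial^j]}U$ equals $e_k\tilde{R}^{ijkl}U^l$ with components defined by $$\tilde{R}^{ijkl}=\partial^i(\mathcal{D}^{km})\,\partial^j(\mathcal{D}^{ml})-\partial^j(\mathcal{D}^{km})\,\partial^i(\mathcal{D}^{ml}).$$ The scalar curvature is $S=\mathcal{P}^{jl}\mathcal{P}^{ik}\tilde{R}^{ijkl}$ (products in this order), where $\mathcal{P}^{ij}=\frac{1}{i\hbar}[X^i,X^j]$.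 *)

theory Defs
  imports
    "HOL-Algebra.Algebraic_Closure_Type"
    "HOL-Algebra.Module"
    "HOL-Library.Poly_Mapping"
    "HOL-Analysis.Cartesian_Space"
begin

section \<open>Unital associative \<open>*\<close>-algebras over the complex numbers\<close>

record 'a star_algebra = "(complex, 'a) module" +
  star :: "'a \<Rightarrow> 'a"

text \<open>The library locale \<^locale>\<open>algebra\<close> is restricted to commutative algebras.\<close>

locale complex_star_algebra =
  module "ring_of_type_algebra :: complex ring" A + ring A
  for A :: "('a, 'm) star_algebra_scheme" (structure) +
  assumes smult_mult_left:
      "x \<in> carrier A \<Longrightarrow> y \<in> carrier A \<Longrightarrow> (c \<odot> x) \<otimes> y = c \<odot> (x \<otimes> y)"
    and smult_mult_right:
      "x \<in> carrier A \<Longrightarrow> y \<in> carrier A \<Longrightarrow> x \<otimes> (c \<odot> y) = c \<odot> (x \<otimes> y)"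
    and star_closed: "x \<in> carrier A \<Longrightarrow> star A x \<in> carrier A"
    and star_star: "x \<in> carrier A \<Longrightarrow> star A (star A x) = x"
    and star_add:
      "x \<in> carrier A \<Longrightarrow> y \<in> carrier A \<Longrightarrow> star A (x \<oplus> y) = star A x \<oplus> star A y"
    and star_mult:
      "x \<in> carrier A \<Longrightarrow> y \<in> carrier A \<Longrightarrow> star A (x \<otimes> y) = star A y \<otimes> star A x"
    and star_smult: "x \<in> carrier A \<Longrightarrow> star A (c \<odot> x) = cnj c \<odot> star A x"

definition commutator :: "('a, 'm) ring_scheme \<Rightarrow> 'a \<Rightarrow> 'a \<Rightarrow> 'a" where
  "commutator A a b = a \<otimes>\<^bsub>A\<^esub> b \<ominus>\<^bsub>A\<^esub> b \<otimes>\<^bsub>A\<^esub> a"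


section \<open>The free \<open>*\<close>-algebra on three hermitian generators\<close>

text \<open>Indices range over the three-element type \<^typ>\<open>3\<close>, whose elements are \<open>1\<close>, \<open>2\<close> and \<open>3\<close>
  (where \<open>3\<close> coincides with \<open>0\<close>). A noncommutative monomial is a word in the generators; words
  form a monoid under concatenation, written additively so that the convolution product of
  \<^theory>\<open>HOL-Library.Poly_Mapping\<close> is the product of noncommutative polynomials.\<close>

datatype monomial = Monomial "3 list"

fun letters :: "monomial \<Rightarrow> 3 list" where
  "letters (Monomial u) = u"

instantiation monomial :: monoid_add
begin

definition zero_monomial :: monomial where
  "zero_monomial = Monomial []"

definition plus_monomial :: "monomial \<Rightarrow> monomial \<Rightarrow> monomial" where
  "plus_monomial u v = Monomial (letters u @ letters v)"

instance
proof
  fix a b c :: monomial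
  show "a + b + c = a + (b + c)" by (simp add: plus_monomial_def)
  show "0 + a = a" by (cases a) (simp add: plus_monomial_def zero_monomial_def)
  show "a + 0 = a" by (cases a) (simp add: plus_monomial_def zero_monomial_def)
qed

end

type_synonym free_algebra = "monomial \<Rightarrow>\<^sub>0 complex"

definition free_gen :: "3 \<Rightarrow> free_algebra" where
  "free_gen i = Poly_Mapping.single (Monomial [i]) 1"

definition free_scale :: "complex \<Rightarrow> free_algebra \<Rightarrow> free_algebra" where
  "free_scale c a = Poly_Mapping.single 0 c * a"

definition rev_monomial :: "monomial \<Rightarrow> monomial" where
  "rev_monomial u = Monomial (rev (letters u))"

lemma rev_monomial_rev_monomial [simp]: "rev_monomial (rev_monomial u) = u"
  by (cases u) (simp add: rev_monomial_def)

lemma rev_monomial_add: "rev_monomial (u + v) = rev_monomial v + rev_monomial u"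
  by (simp add: rev_monomial_def plus_monomial_def)

text \<open>The antilinear antiautomorphism fixing every generator.\<close>

lift_definition free_star :: "free_algebra \<Rightarrow> free_algebra"
  is "\<lambda>f u. cnj (f (rev_monomial u))"
proof -
  fix f :: "monomial \<Rightarrow> complex"
  assume "finite {u. f u \<noteq> 0}"
  moreover have "{u. cnj (f (rev_monomial u)) \<noteq> 0} = rev_monomial ` {u. f u \<noteq> 0}"
    by (auto simp: image_iff intro!: exI[of _ "rev_monomial _"])
  ultimately show "finite {u. cnj (f (rev_monomial u)) \<noteq> 0}" by simp
qed

abbreviation free_ring :: "free_algebra ring" where
  "free_ring \<equiv> ring_of_type_algebra"


section \<open>The fuzzy sphere\<close>

definition levi_civita :: "3 \<Rightarrow> 3 \<Rightarrow> 3 \<Rightarrow> complex" (\<open>\<epsilon>\<close>) where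
  "\<epsilon> i j k =
     (if (i, j, k) \<in> {(1, 2, 3), (2, 3, 1), (3, 1, 2)} then 1
      else if (i, j, k) \<in> {(2, 1, 3), (1, 3, 2), (3, 2, 1)} then -1
      else 0)"

definition fuzzy_relators :: "real \<Rightarrow> free_algebra set" where
  "fuzzy_relators h =
     {free_gen i * free_gen j - free_gen j * free_gen i
        - (\<Sum>k\<in>UNIV. free_scale (\<i> * of_real h * \<epsilon> i j k) (free_gen k)) | i j. True}
     \<union> {(\<Sum>i\<in>UNIV. free_gen i * free_gen i) - 1}"

text \<open>The two-sided ideal generated by the relators; it is closed under \<^const>\<open>free_star\<close>
  (lemma \<open>free_star_fuzzy_ideal\<close> below), so that the quotient is a \<open>*\<close>-algebra.\<close>

definition fuzzy_ideal :: "real \<Rightarrow> free_algebra set" where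
  "fuzzy_ideal h = Idl\<^bsub>free_ring\<^esub> (fuzzy_relators h)"

text \<open>The ring structure is that of the library's quotient ring. As in the library's
  definition of the product of cosets, scalar multiplication and star are
  written as unions over all representatives.\<close>

definition fuzzy_sphere :: "real \<Rightarrow> free_algebra set star_algebra" where
  "fuzzy_sphere h =
     \<lparr>carrier = carrier (free_ring Quot fuzzy_ideal h),
      monoid.mult = monoid.mult (free_ring Quot fuzzy_ideal h),
      one = \<one>\<^bsub>free_ring Quot fuzzy_ideal h\<^esub>,
      ring.zero = \<zero>\<^bsub>free_ring Quot fuzzy_ideal h\<^esub>,
      add = ring.add (free_ring Quot fuzzy_ideal h),
      module.smult = (\<lambda>c A. \<Union>a\<in>A. fuzzy_ideal h +>\<^bsub>free_ring\<^esub> free_scale c a),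
      star = (\<lambda>A. \<Union>a\<in>A. fuzzy_ideal h +>\<^bsub>free_ring\<^esub> free_star a)\<rparr>"

definition fuzzy_gen :: "real \<Rightarrow> 3 \<Rightarrow> free_algebra set" where
  "fuzzy_gen h i = fuzzy_ideal h +>\<^bsub>free_ring\<^esub> free_gen i"


subsection \<open>The fuzzy sphere is a \<open>*\<close>-algebra satisfying the defining relations\<close>

lemma ring_free_ring: "ring free_ring"
proof -
  have "\<exists>y. x + y = 0" for x :: free_algebra
    using add.right_inverse by blast
  moreover have "\<exists>y. y + x = 0 \<and> x + y = 0" for x :: free_algebra
    by (rule exI[of _ "- x"]) simp
  ultimately show ?thesis
    unfolding ring_of_type_algebra_def
    by unfold_locales (auto simp: algebra_simps Units_def)
qed

lemma free_ring_simps [simp]: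
  "carrier free_ring = UNIV" "monoid.mult free_ring = (*)" "\<one>\<^bsub>free_ring\<^esub> = 1"
  "\<zero>\<^bsub>free_ring\<^esub> = 0" "add free_ring = (+)"
  by (simp_all add: ring_of_type_algebra_def)

lemma a_inv_free_ring [simp]: "\<ominus>\<^bsub>free_ring\<^esub> a = - a"
proof -
  interpret ring free_ring by (rule ring_free_ring)
  show ?thesis
    using minus_equality[of "- a" a] by simp
qed

lemma ideal_fuzzy_ideal: "ideal (fuzzy_ideal h) free_ring"
  unfolding fuzzy_ideal_def
  by (rule ring.genideal_ideal[OF ring_free_ring]) simp

lemma fuzzy_relators_subset: "fuzzy_relators h \<subseteq> fuzzy_ideal h"
  unfolding fuzzy_ideal_def
  by (rule ring.genideal_self[OF ring_free_ring]) simp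

lemma fuzzy_ideal_0 [simp]: "0 \<in> fuzzy_ideal h"
  using additive_subgroup.zero_closed[OF ideal.axioms(1)[OF ideal_fuzzy_ideal[of h]]] by simp

lemma fuzzy_ideal_add: "a \<in> fuzzy_ideal h \<Longrightarrow> b \<in> fuzzy_ideal h \<Longrightarrow> a + b \<in> fuzzy_ideal h"
  using additive_subgroup.a_closed[OF ideal.axioms(1)[OF ideal_fuzzy_ideal[of h]]] by simp

lemma fuzzy_ideal_mult_left: "a \<in> fuzzy_ideal h \<Longrightarrow> x * a \<in> fuzzy_ideal h"
  using ideal.I_l_closed[OF ideal_fuzzy_ideal[of h], of a x] by simp

lemma fuzzy_ideal_mult_right: "a \<in> fuzzy_ideal h \<Longrightarrow> a * x \<in> fuzzy_ideal h"
  using ideal.I_r_closed[OF ideal_fuzzy_ideal[of h], of a x] by simp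

lemma fuzzy_ideal_uminus: "a \<in> fuzzy_ideal h \<Longrightarrow> - a \<in> fuzzy_ideal h"
  using fuzzy_ideal_mult_left[of a h "- 1"] by simp

lemma fuzzy_ideal_diff: "a \<in> fuzzy_ideal h \<Longrightarrow> b \<in> fuzzy_ideal h \<Longrightarrow> a - b \<in> fuzzy_ideal h"
  using fuzzy_ideal_add[of a h "- b"] fuzzy_ideal_uminus[of b h] by simp

lemma free_star_add: "free_star (a + b) = free_star a + free_star b"
  by transfer (simp add: fun_eq_iff)

lemma free_star_uminus: "free_star (- a) = - free_star a"
  by transfer (simp add: fun_eq_iff)

lemma free_star_diff: "free_star (a - b) = free_star a - free_star b"
  by transfer (simp add: fun_eq_iff)

lemma free_star_0 [simp]: "free_star 0 = 0"
  by transfer simp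

lemma free_star_sum: "free_star (sum f S) = (\<Sum>x\<in>S. free_star (f x))"
  by (induction S rule: infinite_finite_induct) (simp_all add: free_star_add)

lemma free_star_free_star [simp]: "free_star (free_star a) = a"
  by transfer (simp add: fun_eq_iff)

lemma free_star_single:
  "free_star (Poly_Mapping.single u c) = Poly_Mapping.single (rev_monomial u) (cnj c)"
  by transfer (auto simp: fun_eq_iff when_def)

lemma poly_mapping_sum_single:
  fixes a :: free_algebra
  shows "a = (\<Sum>u\<in>Poly_Mapping.keys a. Poly_Mapping.single u (Poly_Mapping.lookup a u))"
  by (rule poly_mapping_eqI) (auto simp: lookup_sum lookup_single when_def in_keys_iff)

lemma free_star_mult: "free_star (a * b) = free_star b * free_star a"
proof -
  have "free_star ((\<Sum>u\<in>S. Poly_Mapping.single u (f u)) * (\<Sum>v\<in>T. Poly_Mapping.single v (g v)))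
      = free_star (\<Sum>v\<in>T. Poly_Mapping.single v (g v)) * free_star (\<Sum>u\<in>S. Poly_Mapping.single u (f u))"
    for f g and S T :: "monomial set"
    by (simp add: sum_product free_star_sum free_star_single mult_single rev_monomial_add
        mult.commute sum.swap[of _ T S])
  then show ?thesis
    by (metis poly_mapping_sum_single)
qed

lemma free_star_1 [simp]: "free_star 1 = 1"
  by (metis free_star_free_star free_star_mult mult_1 mult_1_right)

lemma free_star_free_gen [simp]: "free_star (free_gen i) = free_gen i"
  by (simp add: free_gen_def free_star_single rev_monomial_def)

lemma free_scale_commute: "Poly_Mapping.single 0 c * a = a * Poly_Mapping.single (0::monomial) c"
  for c :: complex
proof -
  have "Poly_Mapping.single 0 c * (\<Sum>u\<in>S. Poly_Mapping.single u (f u)) =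
      (\<Sum>u\<in>S. Poly_Mapping.single u (f u)) * Poly_Mapping.single (0::monomial) c"
    for f and S :: "monomial set"
    by (simp add: sum_distrib_left sum_distrib_right mult_single mult.commute)
  then show ?thesis
    by (metis poly_mapping_sum_single)
qed

lemma free_star_free_scale: "free_star (free_scale c a) = free_scale (cnj c) (free_star a)"
proof -
  have "rev_monomial 0 = 0"
    by (simp add: rev_monomial_def zero_monomial_def)
  then show ?thesis
    by (simp add: free_scale_def free_star_mult free_star_single
        free_scale_commute[of "cnj c" "free_star a"])
qed

lemma levi_civita_swap: "\<epsilon> j i k = - \<epsilon> i j k"
  using exhaust_3[of i] exhaust_3[of j] exhaust_3[of k] by (auto simp: levi_civita_def)

lemma free_scale_uminus: "free_scale (- c) a = - free_scale c a"
  by (simp add: free_scale_def single_uminus)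

lemma free_star_fuzzy_relators: "a \<in> fuzzy_relators h \<Longrightarrow> free_star a \<in> fuzzy_relators h"
proof -
  have "free_star (free_gen i * free_gen j - free_gen j * free_gen i
        - (\<Sum>k\<in>UNIV. free_scale (\<i> * of_real h * \<epsilon> i j k) (free_gen k))) =
      free_gen j * free_gen i - free_gen i * free_gen j
        - (\<Sum>k\<in>UNIV. free_scale (\<i> * of_real h * \<epsilon> j i k) (free_gen k))" for i j
  proof -
    have "cnj (\<epsilon> i j k) = \<epsilon> i j k" for k
      by (simp add: levi_civita_def)
    then show ?thesis
      by (simp add: free_star_diff free_star_mult free_star_sum free_star_free_scale
          levi_civita_swap[of j i])
  qed
  moreover have "free_star ((\<Sum>i\<in>UNIV. free_gen i * free_gen i) - 1)
      = (\<Sum>i\<in>UNIV. free_gen i * free_gen i) - 1"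
    by (simp add: free_star_diff free_star_sum free_star_mult)
  ultimately show "a \<in> fuzzy_relators h \<Longrightarrow> free_star a \<in> fuzzy_relators h"
    unfolding fuzzy_relators_def by fastforce
qed

lemma free_star_fuzzy_ideal: "a \<in> fuzzy_ideal h \<Longrightarrow> free_star a \<in> fuzzy_ideal h"
proof -
  interpret ring free_ring by (rule ring_free_ring)
  have inv: "inv\<^bsub>add_monoid free_ring\<^esub> x = - x" for x
    using a_inv_free_ring[of x] by (simp only: a_inv_def)
  have "ideal {a. free_star a \<in> fuzzy_ideal h} free_ring"
  proof (rule idealI[OF ring_free_ring])
    show "subgroup {a. free_star a \<in> fuzzy_ideal h} (add_monoid free_ring)"
    proof (rule subgroup.intro)
      fix a assume "a \<in> {a. free_star a \<in> fuzzy_ideal h}"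
      then show "inv\<^bsub>add_monoid free_ring\<^esub> a \<in> {a. free_star a \<in> fuzzy_ideal h}"
        unfolding inv by (simp add: free_star_uminus fuzzy_ideal_uminus)
    qed (simp_all add: free_star_add fuzzy_ideal_add)
  qed (auto simp: free_star_mult fuzzy_ideal_mult_left fuzzy_ideal_mult_right)
  moreover have "fuzzy_relators h \<subseteq> {a. free_star a \<in> fuzzy_ideal h}"
    using free_star_fuzzy_relators fuzzy_relators_subset by blast
  ultimately have "fuzzy_ideal h \<subseteq> {a. free_star a \<in> fuzzy_ideal h}"
    unfolding fuzzy_ideal_def by (rule genideal_minimal)
  then show "a \<in> fuzzy_ideal h \<Longrightarrow> free_star a \<in> fuzzy_ideal h" by blast
qed

definition fuzzy_class :: "real \<Rightarrow> free_algebra \<Rightarrow> free_algebra set" where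
  "fuzzy_class h a = fuzzy_ideal h +>\<^bsub>free_ring\<^esub> a"

lemma mem_fuzzy_class: "b \<in> fuzzy_class h a \<longleftrightarrow> b - a \<in> fuzzy_ideal h"
proof -
  have "b \<in> fuzzy_class h a \<longleftrightarrow> (\<exists>x\<in>fuzzy_ideal h. b = x + a)"
    by (auto simp: fuzzy_class_def a_r_coset_def r_coset_def)
  also have "\<dots> \<longleftrightarrow> b - a \<in> fuzzy_ideal h"
    by (auto intro!: bexI[of _ "b - a"])
  finally show ?thesis .
qed

lemma fuzzy_class_eq_iff: "fuzzy_class h a = fuzzy_class h b \<longleftrightarrow> a - b \<in> fuzzy_ideal h"
proof
  assume "fuzzy_class h a = fuzzy_class h b"
  then show "a - b \<in> fuzzy_ideal h"
    by (metis diff_self fuzzy_ideal_0 mem_fuzzy_class)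
next
  assume *: "a - b \<in> fuzzy_ideal h"
  have "x - a \<in> fuzzy_ideal h \<longleftrightarrow> x - b \<in> fuzzy_ideal h" for x
    using fuzzy_ideal_add[OF _ *, of "x - a"] fuzzy_ideal_diff[OF _ *, of "x - b"]
    by (auto simp: algebra_simps)
  then show "fuzzy_class h a = fuzzy_class h b"
    by (auto simp: mem_fuzzy_class)
qed

lemma fuzzy_class_self: "a \<in> fuzzy_class h a"
  by (simp add: mem_fuzzy_class)

lemma carrier_fuzzy_sphere: "carrier (fuzzy_sphere h) = range (fuzzy_class h)"
  by (auto simp: fuzzy_sphere_def FactRing_def A_RCOSETS_defs fuzzy_class_def a_r_coset_def)

lemma mult_fuzzy_class:
  "fuzzy_class h a \<otimes>\<^bsub>fuzzy_sphere h\<^esub> fuzzy_class h b = fuzzy_class h (a * b)"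
  using ideal.rcoset_mult_add[OF ideal_fuzzy_ideal, of a b h]
  by (simp add: fuzzy_sphere_def FactRing_def fuzzy_class_def)

lemma add_fuzzy_class:
  "fuzzy_class h a \<oplus>\<^bsub>fuzzy_sphere h\<^esub> fuzzy_class h b = fuzzy_class h (a + b)"
  using abelian_subgroup.a_rcos_sum[OF
      abelian_subgroupI3[OF ideal.axioms(1)[OF ideal_fuzzy_ideal]
        ring.is_abelian_group[OF ring_free_ring]], of a b h]
  by (simp add: fuzzy_sphere_def FactRing_def fuzzy_class_def)

lemma one_fuzzy_class: "\<one>\<^bsub>fuzzy_sphere h\<^esub> = fuzzy_class h 1"
  by (simp add: fuzzy_sphere_def FactRing_def fuzzy_class_def)

lemma zero_fuzzy_class: "\<zero>\<^bsub>fuzzy_sphere h\<^esub> = fuzzy_class h 0"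
  by (auto simp: fuzzy_sphere_def FactRing_def mem_fuzzy_class)

lemma smult_fuzzy_class:
  "c \<odot>\<^bsub>fuzzy_sphere h\<^esub> fuzzy_class h a = fuzzy_class h (free_scale c a)"
proof -
  have "fuzzy_class h (free_scale c b) = fuzzy_class h (free_scale c a)"
    if "b \<in> fuzzy_class h a" for b
    using that fuzzy_ideal_mult_left[of "b - a" h "Poly_Mapping.single 0 c"]
    by (simp add: fuzzy_class_eq_iff mem_fuzzy_class free_scale_def right_diff_distrib)
  then have "(\<Union>b\<in>fuzzy_class h a. fuzzy_class h (free_scale c b)) = fuzzy_class h (free_scale c a)"
    using fuzzy_class_self by blast
  then show ?thesis
    by (simp add: fuzzy_sphere_def fuzzy_class_def)
qed

lemma star_fuzzy_class:
  "star (fuzzy_sphere h) (fuzzy_class h a) = fuzzy_class h (free_star a)"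
proof -
  have "fuzzy_class h (free_star b) = fuzzy_class h (free_star a)"
    if "b \<in> fuzzy_class h a" for b
    using that free_star_fuzzy_ideal[of "b - a" h]
    by (simp add: fuzzy_class_eq_iff mem_fuzzy_class free_star_diff)
  then have "(\<Union>b\<in>fuzzy_class h a. fuzzy_class h (free_star b)) = fuzzy_class h (free_star a)"
    using fuzzy_class_self by blast
  then show ?thesis
    by (simp add: fuzzy_sphere_def fuzzy_class_def)
qed

lemmas fuzzy_class_ops = carrier_fuzzy_sphere mult_fuzzy_class add_fuzzy_class one_fuzzy_class
  zero_fuzzy_class smult_fuzzy_class star_fuzzy_class

lemma ring_fuzzy_sphere: "ring (fuzzy_sphere h)"
proof (rule ringI)
  show "abelian_group (fuzzy_sphere h)"
  proof (rule abelian_groupI)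
    fix x assume "x \<in> carrier (fuzzy_sphere h)"
    then obtain a where "x = fuzzy_class h a" by (auto simp: fuzzy_class_ops)
    then show "\<exists>y\<in>carrier (fuzzy_sphere h). y \<oplus>\<^bsub>fuzzy_sphere h\<^esub> x = \<zero>\<^bsub>fuzzy_sphere h\<^esub>"
      by (auto simp: fuzzy_class_ops intro!: exI[of _ "- a"])
  qed (auto simp: fuzzy_class_ops algebra_simps)
  show "Group.monoid (fuzzy_sphere h)"
    by (rule monoidI) (auto simp: fuzzy_class_ops algebra_simps)
qed (auto simp: fuzzy_class_ops algebra_simps)

theorem complex_star_algebra_fuzzy_sphere: "complex_star_algebra (fuzzy_sphere h)"
proof -
  have assoc: "free_scale (c * d) a = free_scale c (free_scale d a)" for c d a
    by (simp add: free_scale_def mult_single flip: mult.assoc)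
  have right: "a * free_scale c b = free_scale c (a * b)" for a b c
    unfolding free_scale_def by (metis free_scale_commute mult.assoc)
  have complex_ring: "carrier (ring_of_type_algebra :: complex ring) = UNIV"
    "monoid.mult (ring_of_type_algebra :: complex ring) = (*)"
    "\<one>\<^bsub>ring_of_type_algebra :: complex ring\<^esub> = 1"
    "add (ring_of_type_algebra :: complex ring) = (+)"
    by (simp_all add: ring_of_type_algebra_def)
  have "module (ring_of_type_algebra :: complex ring) (fuzzy_sphere h)"
    by (rule moduleI)
      (auto intro: ring.is_abelian_group[OF ring_fuzzy_sphere]
        simp: cring_from_type_algebra fuzzy_class_ops complex_ring assoc,
        auto simp: free_scale_def algebra_simps single_add)
  then show ?thesis
    by (intro complex_star_algebra.intro complex_star_algebra_axioms.intro ring_fuzzy_sphere)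
      (auto simp: fuzzy_class_ops right free_star_add free_star_mult free_star_free_scale,
       auto simp: free_scale_def mult.assoc)
qed

lemma fuzzy_gen_eq_class: "fuzzy_gen h i = fuzzy_class h (free_gen i)"
  by (simp add: fuzzy_gen_def fuzzy_class_def)

lemma fuzzy_gen_closed: "fuzzy_gen h i \<in> carrier (fuzzy_sphere h)"
  by (simp add: fuzzy_gen_eq_class fuzzy_class_ops)

lemma finsum_fuzzy_class:
  assumes "finite S"
  shows "(\<Oplus>\<^bsub>fuzzy_sphere h\<^esub> x \<in> S. fuzzy_class h (f x)) = fuzzy_class h (sum f S)"
proof -
  interpret ring "fuzzy_sphere h" by (rule ring_fuzzy_sphere)
  show ?thesis
    using assms by (induction S) (auto simp: fuzzy_class_ops Pi_def)
qed

lemma minus_fuzzy_class: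
  "fuzzy_class h a \<ominus>\<^bsub>fuzzy_sphere h\<^esub> fuzzy_class h b = fuzzy_class h (a - b)"
proof -
  interpret ring "fuzzy_sphere h" by (rule ring_fuzzy_sphere)
  have "\<ominus>\<^bsub>fuzzy_sphere h\<^esub> fuzzy_class h b = fuzzy_class h (- b)"
    by (rule minus_equality) (auto simp: fuzzy_class_ops)
  then show ?thesis by (simp add: a_minus_def fuzzy_class_ops)
qed

theorem fuzzy_gen_hermitian: "star (fuzzy_sphere h) (fuzzy_gen h i) = fuzzy_gen h i"
  by (simp add: fuzzy_gen_eq_class fuzzy_class_ops)

theorem fuzzy_gen_commutator:
  "commutator (fuzzy_sphere h) (fuzzy_gen h i) (fuzzy_gen h j) =
     (\<Oplus>\<^bsub>fuzzy_sphere h\<^esub> k \<in> UNIV. (\<i> * of_real h * \<epsilon> i j k) \<odot>\<^bsub>fuzzy_sphere h\<^esub> fuzzy_gen h k)"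
proof -
  have "free_gen i * free_gen j - free_gen j * free_gen i
      - (\<Sum>k\<in>UNIV. free_scale (\<i> * of_real h * \<epsilon> i j k) (free_gen k)) \<in> fuzzy_ideal h"
    using fuzzy_relators_subset[of h] unfolding fuzzy_relators_def by blast
  then show ?thesis
    by (simp add: commutator_def fuzzy_gen_eq_class fuzzy_class_ops minus_fuzzy_class
        finsum_fuzzy_class fuzzy_class_eq_iff)
qed

theorem fuzzy_gen_sphere:
  "(\<Oplus>\<^bsub>fuzzy_sphere h\<^esub> i \<in> UNIV. fuzzy_gen h i \<otimes>\<^bsub>fuzzy_sphere h\<^esub> fuzzy_gen h i) = \<one>\<^bsub>fuzzy_sphere h\<^esub>"
proof -
  have "(\<Sum>i\<in>UNIV. free_gen i * free_gen i) - 1 \<in> fuzzy_ideal h"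
    using fuzzy_relators_subset[of h] unfolding fuzzy_relators_def by blast
  then show ?thesis
    by (simp add: fuzzy_gen_eq_class fuzzy_class_ops finsum_fuzzy_class fuzzy_class_eq_iff)
qed


section \<open>Projections, derivations and curvature\<close>

text \<open>The deformation parameter \<open>h\<close> plays the role of Planck's constant. The component
  \<open>fuzzy_curvature h i j k l\<close> is the \<open>(k, l)\<close> matrix entry of the curvature operator, in the
  directions of the derivations \<open>i\<close> and \<open>j\<close>, of the projected connection
  \<open>\<nabla>\<^sup>i U = D \<partial>\<^sup>i U\<close> on the projective right module \<open>D(S2\<^sup>3)\<close>.\<close>

context
  fixes h :: real
begin

private abbreviation (input) S2 :: "free_algebra set star_algebra" where
  "S2 \<equiv> fuzzy_sphere h"

private abbreviation (input) x :: "3 \<Rightarrow> free_algebra set" where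
  "x \<equiv> fuzzy_gen h"

definition fuzzy_Pi :: "3 \<Rightarrow> 3 \<Rightarrow> free_algebra set" where
  "fuzzy_Pi i j = x i \<otimes>\<^bsub>S2\<^esub> x j"

definition fuzzy_D :: "3 \<Rightarrow> 3 \<Rightarrow> free_algebra set" where
  "fuzzy_D i j = (if i = j then \<one>\<^bsub>S2\<^esub> else \<zero>\<^bsub>S2\<^esub>) \<ominus>\<^bsub>S2\<^esub> fuzzy_Pi i j"

definition fuzzy_deriv :: "3 \<Rightarrow> free_algebra set \<Rightarrow> free_algebra set" where
  "fuzzy_deriv i a = (1 / (\<i> * of_real h)) \<odot>\<^bsub>S2\<^esub> commutator S2 (x i) a"

definition fuzzy_P :: "3 \<Rightarrow> 3 \<Rightarrow> free_algebra set" where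
  "fuzzy_P i j = (1 / (\<i> * of_real h)) \<odot>\<^bsub>S2\<^esub> commutator S2 (x i) (x j)"

definition fuzzy_curvature :: "3 \<Rightarrow> 3 \<Rightarrow> 3 \<Rightarrow> 3 \<Rightarrow> free_algebra set" where
  "fuzzy_curvature i j k l =
     (\<Oplus>\<^bsub>S2\<^esub> m \<in> UNIV.
        fuzzy_deriv i (fuzzy_D k m) \<otimes>\<^bsub>S2\<^esub> fuzzy_deriv j (fuzzy_D m l)
        \<ominus>\<^bsub>S2\<^esub> fuzzy_deriv j (fuzzy_D k m) \<otimes>\<^bsub>S2\<^esub> fuzzy_deriv i (fuzzy_D m l))"

definition fuzzy_scalar_curvature :: "free_algebra set" where
  "fuzzy_scalar_curvature =
     (\<Oplus>\<^bsub>S2\<^esub> i \<in> UNIV. \<Oplus>\<^bsub>S2\<^esub> j \<in> UNIV. \<Oplus>\<^bsub>S2\<^esub> k \<in> UNIV. \<Oplus>\<^bsub>S2\<^esub> l \<in> UNIV.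
        fuzzy_P j l \<otimes>\<^bsub>S2\<^esub> fuzzy_P i k \<otimes>\<^bsub>S2\<^esub> fuzzy_curvature i j k l)"

end

end

(* All computations take place in the free algebra modulo the defining ideal. With
   P i j = eps i j k x k and c = i hbar, the relations give c P i j = [x i, x j] and the contractions
   P i m x m = - c x i, x m P i m = c x i, P i k P j k = delta i j - x j x i. As the derivation i
   sends x j to P i j, these contractions turn the definition of the curvature into the stated
   formula, with eps i k p x p read as P i k. The scalar curvature is the contraction of P j l with
   Q j l = P i k R i j k l, and Q j l is a combination of P j l, x j x l, x l x j and delta j l. *)
theory Submission
  imports Defs
begin

section \<open>Scalars and the elements \<open>free_P\<close> in the free algebra\<close>

interpretation free_scale: Modules.module free_scale
  by unfold_locales
    (simp_all add: free_scale_def distrib_left distrib_right single_add mult_single flip: mult.assoc)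

lemma mult_free_scale_left: "free_scale c a * b = free_scale c (a * b)"
  by (simp add: free_scale_def mult.assoc)

text \<open>Constant polynomials are central, so scalars also leave the right factor.\<close>

lemma mult_free_scale_right: "a * free_scale c b = free_scale c (a * b)"
  unfolding free_scale_def by (metis free_scale_commute mult.assoc)

lemmas free_algebra_simps = mult_free_scale_left mult_free_scale_right
  distrib_left distrib_right left_diff_distrib right_diff_distrib
  free_scale.scale_right_distrib free_scale.scale_right_diff_distrib mult.assoc

text \<open>A representative of \<open>fuzzy_P\<close> that is linear in the generators and does not
  involve \<open>h\<close>; \<open>fuzzy_P_eq_class\<close> makes the link.\<close>

definition free_P :: "3 \<Rightarrow> 3 \<Rightarrow> free_algebra" where
  "free_P i j = (\<Sum>k\<in>UNIV. free_scale (\<epsilon> i j k) (free_gen k))"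

lemma free_P_swap: "free_P j i = - free_P i j"
  by (simp add: free_P_def levi_civita_swap[of j i] sum_negf)

text \<open>Each entry is zero or a generator up to sign, so the contraction identities can be
  checked index by index.\<close>

lemma free_P_explicit:
  "free_P i i = 0"
  "free_P 1 2 = free_gen 3" "free_P 2 3 = free_gen 1" "free_P 3 1 = free_gen 2"
  "free_P 2 1 = - free_gen 3" "free_P 3 2 = - free_gen 1" "free_P 1 3 = - free_gen 2"
proof -
  show "free_P i i = 0"
    using exhaust_3[of i] by (auto simp: free_P_def levi_civita_def)
qed (simp_all add: free_P_def sum_3 levi_civita_def)

section \<open>Congruence modulo the defining ideal\<close>

context
  fixes h :: real
begin

text \<open>Equality in the quotient is expressed on representatives, so that type class arithmetic
  applies and no carrier conditions arise.\<close>

definition fuzzy_cong :: "free_algebra \<Rightarrow> free_algebra \<Rightarrow> bool" (infix \<open>\<approx>\<close> 50) where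
  "a \<approx> b \<longleftrightarrow> fuzzy_class h a = fuzzy_class h b"

private abbreviation (input) x :: "3 \<Rightarrow> free_algebra" where
  "x \<equiv> free_gen"

private abbreviation (input) P :: "3 \<Rightarrow> 3 \<Rightarrow> free_algebra" where
  "P \<equiv> free_P"

text \<open>An opaque scalar, unfolded only to meet definitions that mention
  \<open>h\<close>.\<close>

definition ihbar :: complex where
  "ihbar = \<i> * of_real h"

private abbreviation (input) c :: complex where
  "c \<equiv> ihbar"

private abbreviation (input) scale :: "complex \<Rightarrow> free_algebra \<Rightarrow> free_algebra" (infixr \<open>\<cdot>\<close> 75) where
  "r \<cdot> a \<equiv> free_scale r a"

lemma fuzzy_cong_refl [simp]: "a \<approx> a"
  by (simp add: fuzzy_cong_def)

lemma fuzzy_cong_trans [trans]: "a \<approx> b \<Longrightarrow> b \<approx> d \<Longrightarrow> a \<approx> d"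
  by (simp add: fuzzy_cong_def)

(* The general substitution rules of the calculational commands let unification blow up on
   large terms. *)
lemma fuzzy_cong_eq_trans [trans]: "a \<approx> b \<Longrightarrow> b = d \<Longrightarrow> a \<approx> d"
  by simp

lemma fuzzy_eq_cong_trans [trans]: "a = b \<Longrightarrow> b \<approx> d \<Longrightarrow> a \<approx> d"
  by simp

lemma fuzzy_cong_add: "a \<approx> a' \<Longrightarrow> b \<approx> b' \<Longrightarrow> a + b \<approx> a' + b'"
  unfolding fuzzy_cong_def by (metis add_fuzzy_class)

lemma fuzzy_cong_diff: "a \<approx> a' \<Longrightarrow> b \<approx> b' \<Longrightarrow> a - b \<approx> a' - b'"
  unfolding fuzzy_cong_def by (metis minus_fuzzy_class)

lemma fuzzy_cong_mult: "a \<approx> a' \<Longrightarrow> b \<approx> b' \<Longrightarrow> a * b \<approx> a' * b'"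
  unfolding fuzzy_cong_def by (metis mult_fuzzy_class)

lemma fuzzy_cong_scale: "a \<approx> a' \<Longrightarrow> r \<cdot> a \<approx> r \<cdot> a'"
  unfolding fuzzy_cong_def by (metis smult_fuzzy_class)

lemma fuzzy_cong_uminus: "a \<approx> a' \<Longrightarrow> - a \<approx> - a'"
  using fuzzy_cong_diff[OF fuzzy_cong_refl, of a a' 0] by simp

lemma fuzzy_cong_sum: "(\<And>i. i \<in> S \<Longrightarrow> f i \<approx> g i) \<Longrightarrow> sum f S \<approx> sum g S"
  by (induction S rule: infinite_finite_induct) (simp_all add: fuzzy_cong_refl fuzzy_cong_add)

lemmas fuzzy_cong_intros = fuzzy_cong_add fuzzy_cong_diff fuzzy_cong_mult
  fuzzy_cong_scale fuzzy_cong_uminus fuzzy_cong_sum fuzzy_cong_refl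

section \<open>Defining relations and contractions of \<open>P\<close>\<close>

lemma free_gen_commute: "x i * x j \<approx> x j * x i + c \<cdot> P i j"
proof -
  have "x i * x j - x j * x i - (\<Sum>k\<in>UNIV. (c * \<epsilon> i j k) \<cdot> x k) \<in> fuzzy_ideal h"
    using fuzzy_relators_subset[of h] unfolding fuzzy_relators_def ihbar_def by blast
  then show ?thesis
    by (simp add: fuzzy_cong_def fuzzy_class_eq_iff free_P_def free_scale.scale_sum_right diff_diff_eq)
qed

lemma free_gen_commutator: "x i * x j - x j * x i \<approx> c \<cdot> P i j"
  using fuzzy_cong_diff[OF free_gen_commute[of i j] fuzzy_cong_refl, of "x j * x i"] by simp

lemma sum_free_gen_square: "(\<Sum>i\<in>UNIV. x i * x i) \<approx> 1"
proof -
  have "(\<Sum>i\<in>UNIV. x i * x i) - 1 \<in> fuzzy_ideal h"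
    using fuzzy_relators_subset[of h] unfolding fuzzy_relators_def by blast
  then show ?thesis
    by (simp add: fuzzy_cong_def fuzzy_class_eq_iff)
qed

text \<open>Two terms survive and form the commutator of the other two generators: for
  \<open>i = 1\<close> the sum is \<open>x 2 * x 3 - x 3 * x 2\<close>. With the factors exchanged,
  as in the next lemma, the sign flips.\<close>

lemma sum_free_gen_free_P: "(\<Sum>m\<in>UNIV. x m * P i m) \<approx> c \<cdot> x i"
  using exhaust_3[of i] free_gen_commutator[of 2 3] free_gen_commutator[of 3 1]
    free_gen_commutator[of 1 2]
  by (auto simp: sum_3 free_P_explicit)

lemma sum_free_P_free_gen: "(\<Sum>m\<in>UNIV. P i m * x m) \<approx> - (c \<cdot> x i)"
  using exhaust_3[of i] free_gen_commutator[of 3 2] free_gen_commutator[of 1 3]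
    free_gen_commutator[of 2 1]
  by (auto simp: sum_3 free_P_explicit free_scale.scale_minus_right)

lemma sum_free_gen_free_P': "(\<Sum>m\<in>UNIV. x m * P m i) \<approx> - (c \<cdot> x i)"
  using fuzzy_cong_uminus[OF sum_free_gen_free_P[of i]]
  by (simp add: free_P_swap[of _ i] sum_negf)

lemma sum_free_P_free_gen': "(\<Sum>m\<in>UNIV. P m i * x m) \<approx> c \<cdot> x i"
  using fuzzy_cong_uminus[OF sum_free_P_free_gen[of i]]
  by (simp add: free_P_swap[of _ i] sum_negf)

text \<open>On the diagonal the sum is the sphere relation without the square of \<open>x i\<close>.
  Off the diagonal only the third index contributes, and it gives exactly
  \<open>- (x j * x i)\<close>, in this order.\<close>

lemma sum_free_P_free_P:
  "(\<Sum>k\<in>UNIV. P i k * P j k) \<approx> (if i = j then 1 else 0) - x j * x i"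
proof (cases "i = j")
  case True
  have "(\<Sum>k\<in>UNIV. P i k * P i k) = (\<Sum>k\<in>UNIV. x k * x k) - x i * x i"
    using exhaust_3[of i] by (auto simp: sum_3 free_P_explicit)
  then show ?thesis
    using True fuzzy_cong_diff[OF sum_free_gen_square fuzzy_cong_refl] by simp
next
  case False
  then have "(\<Sum>k\<in>UNIV. P i k * P j k) = - (x j * x i)"
    using exhaust_3[of i] exhaust_3[of j] by (auto simp: sum_3 free_P_explicit)
  with False show ?thesis by simp
qed

lemma sum_free_P_free_P':
  "(\<Sum>k\<in>UNIV. P k i * P k j) \<approx> (if i = j then 1 else 0) - x j * x i"
  using sum_free_P_free_P[of i j] by (simp add: free_P_swap[of _ i] free_P_swap[of _ j])

section \<open>Representatives of the derivations and the curvature\<close>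

lemma fuzzy_P_eq_class:
  assumes "h \<noteq> 0"
  shows "fuzzy_P h i j = fuzzy_class h (P i j)"
  using fuzzy_cong_scale[OF free_gen_commutator[of i j], of "1 / c"] assms
  by (simp add: fuzzy_cong_def ihbar_def fuzzy_P_def commutator_def fuzzy_gen_eq_class
      fuzzy_class_ops minus_fuzzy_class)

lemma fuzzy_D_eq_class: "fuzzy_D h k m = fuzzy_class h ((if k = m then 1 else 0) - x k * x m)"
  by (simp add: fuzzy_D_def fuzzy_Pi_def fuzzy_gen_eq_class fuzzy_class_ops minus_fuzzy_class)

text \<open>The unit commutes with \<open>x i\<close>, so only \<open>- (x k * x m)\<close>
  contributes, by the Leibniz rule for the commutator. The factor \<open>c\<close> then cancels
  against \<open>1 / c\<close>.\<close>

lemma fuzzy_deriv_D: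
  assumes "h \<noteq> 0"
  shows "fuzzy_deriv h i (fuzzy_D h k m) = fuzzy_class h (- (P i k * x m + x k * P i m))"
proof -
  let ?D = "(if k = m then 1 else 0) - x k * x m"
  have "x i * ?D - ?D * x i = - ((x i * x k - x k * x i) * x m + x k * (x i * x m - x m * x i))"
    by (simp add: algebra_simps)
  also have "\<dots> \<approx> - (c \<cdot> P i k * x m + x k * c \<cdot> P i m)"
    by (intro fuzzy_cong_intros free_gen_commutator)
  also have "\<dots> = c \<cdot> - (P i k * x m + x k * P i m)"
    by (simp add: free_algebra_simps)
  finally have "(1 / c) \<cdot> (x i * ?D - ?D * x i) \<approx> (1 / c) \<cdot> c \<cdot> - (P i k * x m + x k * P i m)"
    by (rule fuzzy_cong_scale)
  with assms show ?thesis
    by (simp add: fuzzy_cong_def ihbar_def fuzzy_deriv_def commutator_def fuzzy_D_eq_class fuzzy_gen_eq_class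
        fuzzy_class_ops minus_fuzzy_class)
qed

text \<open>Writing \<open>P\<close> hides the sums over \<open>p\<close> and \<open>q\<close>
  during the computation; \<open>free_curvature_explicit\<close> restores them.\<close>

definition free_curvature :: "3 \<Rightarrow> 3 \<Rightarrow> 3 \<Rightarrow> 3 \<Rightarrow> free_algebra" where
  "free_curvature i j k l =
     P i k * P j l - P j k * P i l - c \<cdot> (x k * x i * P j l) - c \<cdot> (P j k * x i * x l)
     + c \<cdot> (P i k * x j * x l) + c \<cdot> (x k * x j * P i l) + c \<cdot> (x k * P i j * x l)"

text \<open>In each of the four terms of the expanded product the two factors containing
  \<open>m\<close> are adjacent, so each term needs exactly one contraction: the sphere relation,
  \<open>x\<close> with \<open>P\<close>, \<open>P\<close> with \<open>x\<close>, or
  \<open>P\<close> with \<open>P\<close>.\<close>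

lemma sum_deriv_product:
  "(\<Sum>m\<in>UNIV. (P i k * x m + x k * P i m) * (P j m * x l + x m * P j l)) \<approx>
     P i k * P j l + c \<cdot> (P i k * x j * x l) - c \<cdot> (x k * x i * P j l)
     + x k * ((if i = j then 1 else 0) - x j * x i) * x l"
proof -
  have "(\<Sum>m\<in>UNIV. (P i k * x m + x k * P i m) * (P j m * x l + x m * P j l)) =
      P i k * (\<Sum>m\<in>UNIV. x m * x m) * P j l + P i k * (\<Sum>m\<in>UNIV. x m * P j m) * x l
      + x k * (\<Sum>m\<in>UNIV. P i m * x m) * P j l + x k * (\<Sum>m\<in>UNIV. P i m * P j m) * x l"
    by (simp add: free_algebra_simps sum.distrib sum_distrib_left sum_distrib_right)
  also have "\<dots> \<approx> P i k * 1 * P j l + P i k * (c \<cdot> x j) * x l + x k * - (c \<cdot> x i) * P j l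
      + x k * ((if i = j then 1 else 0) - x j * x i) * x l"
    by (intro fuzzy_cong_intros sum_free_gen_square sum_free_gen_free_P
        sum_free_P_free_gen sum_free_P_free_P)
  also have "\<dots> = P i k * P j l + c \<cdot> (P i k * x j * x l) - c \<cdot> (x k * x i * P j l)
     + x k * ((if i = j then 1 else 0) - x j * x i) * x l"
    by (simp add: free_algebra_simps)
  finally show ?thesis .
qed

text \<open>Antisymmetrising \<open>sum_deriv_product\<close> in \<open>i\<close> and
  \<open>j\<close> cancels the Kronecker deltas. The quartic terms leave \<open>x k\<close> times
  the commutator of \<open>x i\<close> and \<open>x j\<close> times \<open>x l\<close>, the source
  of the last term of \<open>free_curvature\<close>.\<close>

lemma fuzzy_curvature_eq_class:
  assumes "h \<noteq> 0"
  shows "fuzzy_curvature h i j k l = fuzzy_class h (free_curvature i j k l)"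
proof -
  let ?d = "\<lambda>i k m. P i k * x m + x k * P i m"
  have "(\<Sum>m\<in>UNIV. ?d i k m * ?d j m l - ?d j k m * ?d i m l) =
      (\<Sum>m\<in>UNIV. ?d i k m * ?d j m l) - (\<Sum>m\<in>UNIV. ?d j k m * ?d i m l)"
    by (rule sum_subtractf)
  also have "\<dots> \<approx>
      (P i k * P j l + c \<cdot> (P i k * x j * x l) - c \<cdot> (x k * x i * P j l)
        + x k * ((if i = j then 1 else 0) - x j * x i) * x l)
      - (P j k * P i l + c \<cdot> (P j k * x i * x l) - c \<cdot> (x k * x j * P i l)
        + x k * ((if j = i then 1 else 0) - x i * x j) * x l)"
    by (rule fuzzy_cong_diff[OF sum_deriv_product sum_deriv_product])
  also have "\<dots> =
      P i k * P j l - P j k * P i l - c \<cdot> (x k * x i * P j l) - c \<cdot> (P j k * x i * x l)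
       + c \<cdot> (P i k * x j * x l) + c \<cdot> (x k * x j * P i l) + x k * (x i * x j - x j * x i) * x l"
    by (simp add: free_algebra_simps)
  also have "\<dots> \<approx>
      P i k * P j l - P j k * P i l - c \<cdot> (x k * x i * P j l) - c \<cdot> (P j k * x i * x l)
       + c \<cdot> (P i k * x j * x l) + c \<cdot> (x k * x j * P i l) + x k * c \<cdot> P i j * x l"
    by (intro fuzzy_cong_intros free_gen_commutator)
  also have "\<dots> = free_curvature i j k l"
    by (simp add: free_curvature_def free_algebra_simps)
  finally have "(\<Sum>m\<in>UNIV. ?d i k m * ?d j m l - ?d j k m * ?d i m l) \<approx> free_curvature i j k l" .
  then show ?thesis
    unfolding fuzzy_curvature_def fuzzy_deriv_D[OF assms] fuzzy_cong_def
    \<comment> \<open>Both derivatives carry a minus sign. Keeping the negated sums undistributed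
      lets \<open>minus_mult_minus\<close> cancel the signs.\<close>
    by (simp add: fuzzy_class_ops minus_fuzzy_class finsum_fuzzy_class
        minus_mult_minus del: minus_add_distrib)
qed

text \<open>Bilinearity alone: the equality already holds between free polynomials.\<close>

lemma free_curvature_explicit:
  "free_curvature i j k l =
     (\<Sum>p\<in>UNIV. \<Sum>q\<in>UNIV. (\<epsilon> i k p * \<epsilon> j l q - \<epsilon> j k p * \<epsilon> i l q) \<cdot> (x p * x q))
     - (\<Sum>q\<in>UNIV. (c * \<epsilon> j l q) \<cdot> (x k * x i * x q))
     - (\<Sum>p\<in>UNIV. (c * \<epsilon> j k p) \<cdot> (x p * x i * x l))
     + (\<Sum>p\<in>UNIV. (c * \<epsilon> i k p) \<cdot> (x p * x j * x l))
     + (\<Sum>q\<in>UNIV. (c * \<epsilon> i l q) \<cdot> (x k * x j * x q))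
     + (\<Sum>p\<in>UNIV. (c * \<epsilon> i j p) \<cdot> (x k * x p * x l))"
proof -
  have PP: "P i j * P k l = (\<Sum>p\<in>UNIV. \<Sum>q\<in>UNIV. (\<epsilon> i j p * \<epsilon> k l q) \<cdot> (x p * x q))" for i j k l
    by (simp add: free_P_def sum_product mult_free_scale_left mult_free_scale_right mult.commute)
  have right: "c \<cdot> (a * P i j) = (\<Sum>q\<in>UNIV. (c * \<epsilon> i j q) \<cdot> (a * x q))" for a i j
    by (simp add: free_P_def sum_distrib_left free_scale.scale_sum_right mult_free_scale_right)
  have left: "c \<cdot> (P i j * b) = (\<Sum>q\<in>UNIV. (c * \<epsilon> i j q) \<cdot> (x q * b))" for b i j
    by (simp add: free_P_def sum_distrib_right free_scale.scale_sum_right mult_free_scale_left)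
  have mid: "c \<cdot> (a * (P i j * b)) = (\<Sum>q\<in>UNIV. (c * \<epsilon> i j q) \<cdot> (a * (x q * b)))" for a b i j
    by (simp add: free_P_def sum_distrib_left sum_distrib_right free_scale.scale_sum_right
        mult_free_scale_left mult_free_scale_right)
  show ?thesis
    \<comment> \<open>Reassociation hides the product in front of \<open>P\<close> from the pattern
      of \<open>right\<close>, so the two instances are supplied and normalised along with the
      goal.\<close>
    using right[of "x k * x i" j l] right[of "x k * x j" i l]
    by (simp add: free_curvature_def PP left mid mult.assoc free_scale.scale_left_diff_distrib
        sum_subtractf)
qed

section \<open>Contractions leading to the scalar curvature\<close>

lemma sum_free_P_square: "(\<Sum>i\<in>UNIV. \<Sum>k\<in>UNIV. P i k * P i k) \<approx> 1 + 1"
proof -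
  have "(\<Sum>i\<in>UNIV. \<Sum>k\<in>UNIV. P i k * P i k) \<approx> (\<Sum>i\<in>UNIV. 1 - x i * x i)"
    using sum_free_P_free_P[of i i for i] by (intro fuzzy_cong_intros) simp
  also have "\<dots> = 3 - (\<Sum>i\<in>UNIV. x i * x i)"
    by (simp add: sum_subtractf)
  also have "\<dots> \<approx> 3 - 1"
    by (intro fuzzy_cong_intros sum_free_gen_square)
  finally show ?thesis by simp
qed

text \<open>Summing over \<open>i\<close> first turns \<open>P i k * x i\<close> into
  \<open>c\<close> times \<open>x k\<close>, and the sphere relation does the rest.\<close>

lemma sum_free_P_gen_gen: "(\<Sum>i\<in>UNIV. \<Sum>k\<in>UNIV. P i k * x i * x k) \<approx> c \<cdot> 1"
proof -
  have "(\<Sum>i\<in>UNIV. \<Sum>k\<in>UNIV. P i k * x i * x k) = (\<Sum>k\<in>UNIV. (\<Sum>i\<in>UNIV. P i k * x i) * x k)"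
    by (subst sum.swap) (simp add: sum_distrib_right)
  also have "\<dots> \<approx> (\<Sum>k\<in>UNIV. c \<cdot> x k * x k)"
    by (intro fuzzy_cong_intros sum_free_P_free_gen')
  also have "\<dots> = c \<cdot> (\<Sum>k\<in>UNIV. x k * x k)"
    by (simp add: mult_free_scale_left free_scale.scale_sum_right)
  also have "\<dots> \<approx> c \<cdot> 1"
    by (intro fuzzy_cong_intros sum_free_gen_square)
  finally show ?thesis .
qed

text \<open>Antisymmetry of \<open>P\<close> and renaming the indices reduce this to the previous
  sum.\<close>

lemma sum_free_P_gen_gen': "(\<Sum>i\<in>UNIV. \<Sum>k\<in>UNIV. P i k * x k * x i) \<approx> - (c \<cdot> 1)"
proof -
  have swap: "P i k * x k * x i = - (P k i * x k * x i)" for i k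
    using free_P_swap[of i k] by simp
  have "(\<Sum>i\<in>UNIV. \<Sum>k\<in>UNIV. P i k * x k * x i) =
      - (\<Sum>i\<in>UNIV. \<Sum>k\<in>UNIV. P k i * x k * x i)"
    by (subst swap) (simp only: sum_negf)
  also have "\<dots> = - (\<Sum>i\<in>UNIV. \<Sum>k\<in>UNIV. P i k * x i * x k)"
    by (subst sum.swap) (rule refl)
  also have "\<dots> \<approx> - (c \<cdot> 1)"
    by (intro fuzzy_cong_uminus sum_free_P_gen_gen)
  finally show ?thesis .
qed

text \<open>Every term of \<open>free_curvature\<close> starts with its only factor containing
  \<open>k\<close>, next to \<open>P i k\<close>. Hence the sum over \<open>k\<close> is contracted
  first and the sum over \<open>i\<close> afterwards.\<close>

lemma sum_free_P_curvature:
  "(\<Sum>i\<in>UNIV. \<Sum>k\<in>UNIV. P i k * free_curvature i j k l) \<approx>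
     P j l + (c * c) \<cdot> P j l + c \<cdot> (x j * x l)
     + (c * c * c) \<cdot> (x j * x l + x j * x l + x l * x j - (if j = l then 1 else 0))"
proof -
  \<comment> \<open>After the contraction over \<open>k\<close>, each remaining sum over
    \<open>i\<close> has the shape of \<open>delta\<close> or of \<open>scaled\<close>.\<close>
  have delta: "(\<Sum>i\<in>UNIV. ((if i = j then 1 else 0) - x j * x i) * b i) =
      b j - x j * (\<Sum>i\<in>UNIV. x i * b i)" for b
    by (simp add: left_diff_distrib sum_subtractf mult_delta_left sum_distrib_left mult.assoc)
  have scaled: "(\<Sum>i\<in>UNIV. - (c \<cdot> x i) * b i) = - (c \<cdot> (\<Sum>i\<in>UNIV. x i * b i))" for b
    by (simp add: mult_free_scale_left sum_negf free_scale.scale_sum_right)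
  have "(\<Sum>i\<in>UNIV. \<Sum>k\<in>UNIV. P i k * free_curvature i j k l) =
      (\<Sum>i\<in>UNIV. \<Sum>k\<in>UNIV. P i k * P i k) * P j l
      - (\<Sum>i\<in>UNIV. (\<Sum>k\<in>UNIV. P i k * P j k) * P i l)
      - c \<cdot> ((\<Sum>i\<in>UNIV. (\<Sum>k\<in>UNIV. P i k * x k) * x i) * P j l)
      - c \<cdot> ((\<Sum>i\<in>UNIV. (\<Sum>k\<in>UNIV. P i k * P j k) * x i) * x l)
      + c \<cdot> ((\<Sum>i\<in>UNIV. \<Sum>k\<in>UNIV. P i k * P i k) * x j * x l)
      + c \<cdot> (\<Sum>i\<in>UNIV. (\<Sum>k\<in>UNIV. P i k * x k) * (x j * P i l))
      + c \<cdot> ((\<Sum>i\<in>UNIV. (\<Sum>k\<in>UNIV. P i k * x k) * P i j) * x l)"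
    by (simp add: free_curvature_def free_algebra_simps sum.distrib sum_subtractf
        sum_distrib_right free_scale.scale_sum_right)
  also have "\<dots> \<approx>
      (1 + 1) * P j l
      - (\<Sum>i\<in>UNIV. ((if i = j then 1 else 0) - x j * x i) * P i l)
      - c \<cdot> ((\<Sum>i\<in>UNIV. - (c \<cdot> x i) * x i) * P j l)
      - c \<cdot> ((\<Sum>i\<in>UNIV. ((if i = j then 1 else 0) - x j * x i) * x i) * x l)
      + c \<cdot> ((1 + 1) * x j * x l)
      + c \<cdot> (\<Sum>i\<in>UNIV. - (c \<cdot> x i) * (x j * P i l))
      + c \<cdot> ((\<Sum>i\<in>UNIV. - (c \<cdot> x i) * P i j) * x l)"
    by (intro fuzzy_cong_add fuzzy_cong_diff fuzzy_cong_mult fuzzy_cong_scale sum_free_P_square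
        sum_free_P_free_P sum_free_P_free_gen fuzzy_cong_sum fuzzy_cong_refl)
  also have "\<dots> =
      (1 + 1) * P j l - (P j l - x j * (\<Sum>i\<in>UNIV. x i * P i l))
      + (c * c) \<cdot> ((\<Sum>i\<in>UNIV. x i * x i) * P j l)
      - c \<cdot> ((x j - x j * (\<Sum>i\<in>UNIV. x i * x i)) * x l)
      + c \<cdot> ((1 + 1) * x j * x l)
      - (c * c) \<cdot> (\<Sum>i\<in>UNIV. x i * x j * P i l)
      - (c * c) \<cdot> ((\<Sum>i\<in>UNIV. x i * P i j) * x l)"
    unfolding delta scaled
    by (simp only: mult_free_scale_left mult_minus_left free_scale.scale_minus_right
        free_scale.scale_scale diff_minus_eq_add add_uminus_conv_diff mult.assoc)
  \<comment> \<open>In one sum \<open>x j\<close> separates \<open>x i\<close> from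
    \<open>P i l\<close>. Moving it to the left adds \<open>c\<close> times \<open>P i j\<close>,
    whose contraction with \<open>P i l\<close> later yields the delta and the reversed product
    \<open>x l * x j\<close>.\<close>
  also have "\<dots> \<approx>
      (1 + 1) * P j l - (P j l - x j * - (c \<cdot> x l)) + (c * c) \<cdot> (1 * P j l)
      - c \<cdot> ((x j - x j * 1) * x l) + c \<cdot> ((1 + 1) * x j * x l)
      - (c * c) \<cdot> (\<Sum>i\<in>UNIV. (x j * x i + c \<cdot> P i j) * P i l)
      - (c * c) \<cdot> (- (c \<cdot> x j) * x l)"
    by (intro fuzzy_cong_add fuzzy_cong_diff fuzzy_cong_mult fuzzy_cong_scale free_gen_commute
        sum_free_gen_square sum_free_gen_free_P' fuzzy_cong_sum fuzzy_cong_refl)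
  also have "\<dots> =
      (1 + 1) * P j l - (P j l - x j * - (c \<cdot> x l)) + (c * c) \<cdot> (1 * P j l)
      - c \<cdot> ((x j - x j * 1) * x l) + c \<cdot> ((1 + 1) * x j * x l)
      - (c * c) \<cdot> (x j * (\<Sum>i\<in>UNIV. x i * P i l) + c \<cdot> (\<Sum>i\<in>UNIV. P i j * P i l))
      - (c * c) \<cdot> (- (c \<cdot> x j) * x l)"
    by (simp only: distrib_right mult_free_scale_left mult.assoc sum.distrib sum_distrib_left
        free_scale.scale_sum_right)
  also have "\<dots> \<approx>
      (1 + 1) * P j l - (P j l - x j * - (c \<cdot> x l)) + (c * c) \<cdot> (1 * P j l)
      - c \<cdot> ((x j - x j * 1) * x l) + c \<cdot> ((1 + 1) * x j * x l)
      - (c * c) \<cdot> (x j * - (c \<cdot> x l) + c \<cdot> ((if j = l then 1 else 0) - x l * x j))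
      - (c * c) \<cdot> (- (c \<cdot> x j) * x l)"
    by (intro fuzzy_cong_add fuzzy_cong_diff fuzzy_cong_mult fuzzy_cong_scale
        sum_free_gen_free_P' sum_free_P_free_P' fuzzy_cong_refl)
  also have "\<dots> =
     P j l + (c * c) \<cdot> P j l + c \<cdot> (x j * x l)
     + (c * c * c) \<cdot> (x j * x l + x j * x l + x l * x j - (if j = l then 1 else 0))"
    by (simp only: free_algebra_simps mult_1_left mult_1_right mult_minus_left mult_minus_right
        free_scale.scale_minus_right free_scale.scale_scale) simp
  finally show ?thesis .
qed

text \<open>The sums \<open>A\<close>, \<open>B\<close>, \<open>C\<close> below have the values 2,
  \<open>c\<close> and \<open>- c\<close>; the delta drops out because \<open>P\<close> vanishes on
  the diagonal. This gives \<open>2 + 2 * c ^ 2 + c ^ 2 + c ^ 4\<close>.\<close>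

lemma fuzzy_scalar_curvature_eq_class:
  assumes "h \<noteq> 0"
  shows "fuzzy_scalar_curvature h = fuzzy_class h ((2 + 3 * c ^ 2 + c ^ 4) \<cdot> 1)"
proof -
  \<comment> \<open>Only the summations are reordered, so that \<open>P j l\<close> can be pulled
    out on the left of the sums over \<open>i\<close> and \<open>k\<close>.\<close>
  have "(\<Sum>i\<in>UNIV. \<Sum>j\<in>UNIV. \<Sum>k\<in>UNIV. \<Sum>l\<in>UNIV. P j l * P i k * free_curvature i j k l) =
      (\<Sum>j\<in>UNIV. \<Sum>i\<in>UNIV. \<Sum>l\<in>UNIV. \<Sum>k\<in>UNIV. P j l * P i k * free_curvature i j k l)"
    by (subst sum.swap) (intro sum.cong refl sum.swap)
  also have "\<dots> = (\<Sum>j\<in>UNIV. \<Sum>l\<in>UNIV. \<Sum>i\<in>UNIV. \<Sum>k\<in>UNIV. P j l * P i k * free_curvature i j k l)"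
    by (intro sum.cong refl sum.swap)
  also have "\<dots> =
      (\<Sum>j\<in>UNIV. \<Sum>l\<in>UNIV. P j l * (\<Sum>i\<in>UNIV. \<Sum>k\<in>UNIV. P i k * free_curvature i j k l))"
    by (simp only: sum_distrib_left mult.assoc)
  also have "\<dots> \<approx> (\<Sum>j\<in>UNIV. \<Sum>l\<in>UNIV. P j l *
      (P j l + (c * c) \<cdot> P j l + c \<cdot> (x j * x l)
       + (c * c * c) \<cdot> (x j * x l + x j * x l + x l * x j - (if j = l then 1 else 0))))"
    by (intro fuzzy_cong_sum fuzzy_cong_mult fuzzy_cong_refl sum_free_P_curvature)
  also have "\<dots> =
      (let A = \<Sum>j\<in>UNIV. \<Sum>l\<in>UNIV. P j l * P j l;
           B = \<Sum>j\<in>UNIV. \<Sum>l\<in>UNIV. P j l * x j * x l;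
           C = \<Sum>j\<in>UNIV. \<Sum>l\<in>UNIV. P j l * x l * x j
       in A + (c * c) \<cdot> A + c \<cdot> B + (c * c * c) \<cdot> (B + B + C))"
  proof -
    have diagonal: "P j l * (a - (if j = l then 1 else 0)) = P j l * a" for j l a
      by (simp add: free_P_explicit)
    show ?thesis
      by (simp only: Let_def distrib_left mult_free_scale_right diagonal mult.assoc sum.distrib
          free_scale.scale_sum_right free_scale.scale_right_distrib)
  qed
  also have "\<dots> \<approx> (1 + 1) + (c * c) \<cdot> (1 + 1) + c \<cdot> c \<cdot> 1
      + (c * c * c) \<cdot> (c \<cdot> 1 + c \<cdot> 1 + - (c \<cdot> 1))"
    unfolding Let_def
    by (intro fuzzy_cong_add fuzzy_cong_scale sum_free_P_square sum_free_P_gen_gen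
        sum_free_P_gen_gen')
  also have "\<dots> = (1 + 1 + c * c * (1 + 1) + c * c + c * c * c * c) \<cdot> 1"
    by (simp only: free_scale.scale_scale free_scale.scale_left_distrib free_scale.scale_one
        free_scale.scale_right_distrib add.right_inverse add_0_right distrib_left mult_1_right
        add.assoc)
  also have "1 + 1 + c * c * (1 + 1) + c * c + c * c * c * c = 2 + 3 * c ^ 2 + c ^ 4"
    by (simp add: power2_eq_square power4_eq_xxxx algebra_simps)
  finally show ?thesis
    by (simp add: fuzzy_cong_def fuzzy_scalar_curvature_def fuzzy_P_eq_class[OF assms]
        fuzzy_curvature_eq_class[OF assms] fuzzy_class_ops finsum_fuzzy_class)
qed

end

section \<open>The curvature identities in the fuzzy sphere\<close>

theorem proposition4p1:
  fixes h :: real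
    and S2 (structure)
    and x :: "3 \<Rightarrow> free_algebra set"
  defines "S2 \<equiv> fuzzy_sphere h"
    and "x \<equiv> fuzzy_gen h"
  assumes "h \<noteq> 0"
  shows "(\<forall>i j k l. fuzzy_curvature h i j k l =
      (\<Oplus> p \<in> UNIV. \<Oplus> q \<in> UNIV.
         (\<epsilon> i k p * \<epsilon> j l q - \<epsilon> j k p * \<epsilon> i l q) \<odot> (x p \<otimes> x q))
      \<ominus> (\<Oplus> q \<in> UNIV. (\<i> * of_real h * \<epsilon> j l q) \<odot> (x k \<otimes> x i \<otimes> x q))
      \<ominus> (\<Oplus> p \<in> UNIV. (\<i> * of_real h * \<epsilon> j k p) \<odot> (x p \<otimes> x i \<otimes> x l))
      \<oplus> (\<Oplus> p \<in> UNIV. (\<i> * of_real h * \<epsilon> i k p) \<odot> (x p \<otimes> x j \<otimes> x l))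
      \<oplus> (\<Oplus> q \<in> UNIV. (\<i> * of_real h * \<epsilon> i l q) \<odot> (x k \<otimes> x j \<otimes> x q))
      \<oplus> (\<Oplus> p \<in> UNIV. (\<i> * of_real h * \<epsilon> i j p) \<odot> (x k \<otimes> x p \<otimes> x l)))
    \<and> fuzzy_scalar_curvature h = of_real (2 - 3 * h\<^sup>2 + h ^ 4) \<odot> \<one>"
proof (intro conjI allI)
  fix i j k l
  show "fuzzy_curvature h i j k l =
      (\<Oplus> p \<in> UNIV. \<Oplus> q \<in> UNIV.
         (\<epsilon> i k p * \<epsilon> j l q - \<epsilon> j k p * \<epsilon> i l q) \<odot> (x p \<otimes> x q))
      \<ominus> (\<Oplus> q \<in> UNIV. (\<i> * of_real h * \<epsilon> j l q) \<odot> (x k \<otimes> x i \<otimes> x q))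
      \<ominus> (\<Oplus> p \<in> UNIV. (\<i> * of_real h * \<epsilon> j k p) \<odot> (x p \<otimes> x i \<otimes> x l))
      \<oplus> (\<Oplus> p \<in> UNIV. (\<i> * of_real h * \<epsilon> i k p) \<odot> (x p \<otimes> x j \<otimes> x l))
      \<oplus> (\<Oplus> q \<in> UNIV. (\<i> * of_real h * \<epsilon> i l q) \<odot> (x k \<otimes> x j \<otimes> x q))
      \<oplus> (\<Oplus> p \<in> UNIV. (\<i> * of_real h * \<epsilon> i j p) \<odot> (x k \<otimes> x p \<otimes> x l))"
    unfolding S2_def x_def
    by (simp add: fuzzy_curvature_eq_class[OF \<open>h \<noteq> 0\<close>] free_curvature_explicit ihbar_def
        fuzzy_gen_eq_class fuzzy_class_ops minus_fuzzy_class finsum_fuzzy_class)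
next
  \<comment> \<open>The square of \<open>ihbar\<close> is \<open>- (h ^ 2)\<close> and its fourth
    power is \<open>h ^ 4\<close>, so the coefficient is real.\<close>
  have "2 + 3 * (\<i> * of_real h) ^ 2 + (\<i> * of_real h) ^ 4 = complex_of_real (2 - 3 * h\<^sup>2 + h ^ 4)"
    by (simp add: power_mult_distrib)
  then show "fuzzy_scalar_curvature h = of_real (2 - 3 * h\<^sup>2 + h ^ 4) \<odot> \<one>"
    unfolding S2_def
    by (simp only: ihbar_def fuzzy_scalar_curvature_eq_class[OF \<open>h \<noteq> 0\<close>] one_fuzzy_class smult_fuzzy_class)
qed

end
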